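(* Let $\gamma,g>0$, let $(H_t,V_t)_{t\ge0}$ be the inert drift process with parameters $\gamma,g$ and state space $S=\mathbb{R}_+\times(-g/\gamma,\infty)$, and let $S_t$ and $X_t$ be the trajectories of the inert particle and of the Brownian particle (defined in the context). For each $(h,\nu)\in S$, $\mathbb{P}_{(h,\nu)}$-almost surely, $$\lim_{t\to\infty}\frac{S_t}{t}=\lim_{t\to\infty}\frac{X_t}{t}=-\frac{g}{1+\gamma}.$$
   Context: Fix $\gamma>0$ and $g>0$. Write $\mathbb{R}_+=[0,\infty)$ and $S=\mathbb{R}_+\times(-g/\gamma,\infty)$. Let $B$ be a one-dimensional standard Brownian motion with $B_0=0$. For $(h,\nu)\in S$, the inert drift process $(H_t,V_t)_{t\ge 0}$ is the continuous $S$-valued process that is the (pathwise unique, strong) solution of $$dH_t=V_t\,dt-dB_t+dL_t,\qquad dV_t=-(\gamma V_t+g)\,dt+dL_t,\qquad (H_0,V_0)=(h,\nu),$$ where $L$ is the unique continuous, non-negative, non-decreasing process such that $\int_0^t \mathbf 1_{\{H_u=0\}}\,dL_u=L_t$ and $H_t\ge 0$ for all $t\ge 0$. It has the representation $L_t=\sup_{u\le t}\left(-h+B_u-\int_0^u V_w\,dw\right)\vee 0$, and $(H,V)$ is a strong Markov process. $\mathbb{P}_{(h,\nu)}$ denotes probability when $(H_0,V_0)=(h,\nu)$. The inert particle has trajectory $S_t=\int_0^t V_u\,du$ (so $S_0=0$), and the Brownian particle has trajectory $X_t=S_t-H_t$; equivalently $dS_t=V_t\,dt$, $dX_t=dB_t-dL_t$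 and $H_t=S_t-X_t$ is the gap. *)

theory Defs
  imports "HOL-Probability.Probability"
begin

locale standard_brownian_motion = prob_space M
  for M :: "'a measure" +
  fixes B :: "real \<Rightarrow> 'a \<Rightarrow> real"
  assumes random_variable_B: "\<And>t. 0 \<le> t \<Longrightarrow> random_variable borel (B t)"
    and starts_at_zero: "AE \<omega> in M. B 0 \<omega> = 0"
    and gaussian_increments: "\<And>s t. 0 \<le> s \<Longrightarrow> s < t \<Longrightarrow>
      distributed M lborel (\<lambda>\<omega>. B t \<omega> - B s \<omega>) (normal_density 0 (sqrt (t - s)))"
    and independent_increments: "\<And>(n::nat) t. 0 \<le> t 0 \<Longrightarrow> (\<forall>i<n. t i < t (Suc i)) \<Longrightarrow>
      indep_vars (\<lambda>_. borel) (\<lambda>i \<omega>. B (t (Suc i)) \<omega> - B (t i) \<omega>) {..<n}"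
    and continuous_paths: "AE \<omega> in M. continuous_on {0..} (\<lambda>t. B t \<omega>)"

definition augmented_filtration ::
    "'a measure \<Rightarrow> (real \<Rightarrow> 'a \<Rightarrow> real) \<Rightarrow> real \<Rightarrow> 'a measure" where
  "augmented_filtration M B t =
    sigma (space M)
      ({B s -` A \<inter> space M | s A. 0 \<le> s \<and> s \<le> t \<and> A \<in> sets borel} \<union> null_sets M)"

text \<open>
  One sample path of the system, with the stochastic differential equations written in
  integrated form; \<open>b\<close> is the driving path. As \<open>b 0 = 0\<close>, the equations at time \<open>0\<close> give
  \<open>L 0 = 0\<close>. The Stieltjes integral against \<open>dL\<close> is the integral with respect to
  \<^const>\<open>interval_measure\<close>, where \<open>L\<close> is extended to negative times by the constant \<open>L 0\<close> so
  that it is monotone and continuous on the whole line.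
\<close>
definition inert_drift_path ::
    "real \<Rightarrow> real \<Rightarrow> real \<Rightarrow> real \<Rightarrow> (real \<Rightarrow> real) \<Rightarrow>
     (real \<Rightarrow> real) \<Rightarrow> (real \<Rightarrow> real) \<Rightarrow> (real \<Rightarrow> real) \<Rightarrow> bool" where
  "inert_drift_path \<gamma> g h \<nu> b H V L \<longleftrightarrow>
    continuous_on {0..} H \<and> continuous_on {0..} V \<and> continuous_on {0..} L \<and>
    (\<forall>t\<ge>0. (H t, V t) \<in> {0..} \<times> {- g / \<gamma><..}) \<and>
    (\<forall>t\<ge>0. H t = h + integral {0..t} V - b t + L t) \<and>
    (\<forall>t\<ge>0. V t = \<nu> - integral {0..t} (\<lambda>u. \<gamma> * V u + g) + L t) \<and>
    (\<forall>t\<ge>0. 0 \<le> L t) \<and> mono_on {0..} L \<and>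
    (\<forall>t\<ge>0. (LINT u:{0..t}|interval_measure (\<lambda>s. L (max 0 s)).
               indicator {u. H u = 0} u) = L t)"

text \<open>
  The adaptedness assumptions express that \<open>(H, V, L)\<close> is a strong solution.
\<close>
locale inert_drift_process = standard_brownian_motion M B
  for M :: "'a measure" and B :: "real \<Rightarrow> 'a \<Rightarrow> real" +
  fixes \<gamma> g h \<nu> :: real
    and H V L :: "real \<Rightarrow> 'a \<Rightarrow> real"
  assumes adapted_H: "\<And>t. 0 \<le> t \<Longrightarrow> H t \<in> borel_measurable (augmented_filtration M B t)"
    and adapted_V: "\<And>t. 0 \<le> t \<Longrightarrow> V t \<in> borel_measurable (augmented_filtration M B t)"
    and adapted_L: "\<And>t. 0 \<le> t \<Longrightarrow> L t \<in> borel_measurable (augmented_filtration M B t)"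
    and solution_paths: "AE \<omega> in M. inert_drift_path \<gamma> g h \<nu>
      (\<lambda>t. B t \<omega>) (\<lambda>t. H t \<omega>) (\<lambda>t. V t \<omega>) (\<lambda>t. L t \<omega>)"

definition inert_trajectory :: "(real \<Rightarrow> 'a \<Rightarrow> real) \<Rightarrow> real \<Rightarrow> 'a \<Rightarrow> real" where
  "inert_trajectory V t \<omega> = integral {0..t} (\<lambda>u. V u \<omega>)"

definition brownian_trajectory ::
    "(real \<Rightarrow> 'a \<Rightarrow> real) \<Rightarrow> (real \<Rightarrow> 'a \<Rightarrow> real) \<Rightarrow> real \<Rightarrow> 'a \<Rightarrow> real" where
  "brownian_trajectory H V t \<omega> = inert_trajectory V t \<omega> - H t \<omega>"

end

theory Submission
  imports Defs
begin

text \<open>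
  Write \<open>S t\<close> for the integral of \<open>V\<close> over \<open>[0, t]\<close>. Subtracting the equation for \<open>H\<close> from the one
  for \<open>V\<close> eliminates the local time \<open>L\<close>:
  \<open>(1 + \<gamma>) * S t = - g * t + b t + H t - V t + (\<nu> - h)\<close>.
  So \<open>S t / t\<close> tends to \<open>- g / (1 + \<gamma>)\<close> as soon as \<open>b\<close>, \<open>H\<close> and \<open>V\<close> are all \<open>o(t)\<close>, and then
  \<open>X = S - H\<close> has the same speed. This is \<open>inert_drift_path_speed\<close>.

  That \<open>H\<close> and \<open>V\<close> are \<open>o(t)\<close> is a deterministic consequence of \<open>b\<close> being \<open>o(t)\<close>. The
  state space bounds both from below. For the upper bounds let \<open>\<beta>\<close> bound \<open>b\<close> in absolute value on \<open>[0, t]\<close>. By the same subtraction, an increment of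
  \<open>V - H\<close> is at most the increment of \<open>b\<close> over any period on which \<open>V \<ge> 0\<close>. Starting the period at
  the last time at which \<open>V\<close> is at the level \<open>max (V 0) 0\<close> and ending it at a contact time, where
  \<open>H = 0\<close>, bounds \<open>V\<close> at contact times by \<open>max (V 0) 0 + 2 * \<beta>\<close>; between contacts \<open>L\<close> is
  constant, so \<open>V\<close> decreases while it is nonnegative (\<open>velocity_upper_bound\<close>). Following \<open>H\<close> from
  the last contact, where \<open>H = 0\<close>, bounds \<open>H\<close> in turn (\<open>gap_upper_bound\<close>).

  The only probabilistic input is that Brownian paths are almost surely \<open>o(t)\<close>
  (\<open>sublinear_paths\<close>). Fourth moments control all dyadic increments on all intervals
  \<open>[0, 2 ^ m]\<close> simultaneously by one random constant (\<open>dyadic_increments_bounded\<close>), and summing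
  increments over dyadic scales (\<open>dyadic_chaining_bound\<close>) then bounds the path on \<open>[0, 2 ^ m]\<close> by
  a multiple of \<open>(3/2) ^ m\<close>.
\<close>

section \<open>Pathwise bounds for velocity and gap\<close>

lemma last_visit:
  fixes f :: "real \<Rightarrow> real"
  assumes cont: "continuous_on {a..t} f" and "u \<in> {a..t}" "f u = c"
  obtains s where "s \<in> {a..t}" "f s = c" "\<And>u. u \<in> {s<..t} \<Longrightarrow> f u \<noteq> c"
proof -
  define Z where "Z = {a..t} \<inter> f -` {c}"
  have "closed Z"
    unfolding Z_def using cont by (intro continuous_closed_preimage) auto
  moreover have "Z \<noteq> {}" "bdd_above Z"
    using assms by (auto simp: Z_def)
  ultimately have "Sup Z \<in> Z" "\<And>u. u \<in> Z \<Longrightarrow> u \<le> Sup Z"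
    by (auto intro: closed_contains_Sup cSup_upper)
  moreover from this have "u \<notin> Z" if "u \<in> {Sup Z<..t}" for u
    using that by force
  ultimately show thesis
    by (intro that[of "Sup Z"]) (auto simp: Z_def)
qed

context
  fixes \<gamma> g h \<nu> :: real and b H V L :: "real \<Rightarrow> real"
  assumes path: "inert_drift_path \<gamma> g h \<nu> b H V L"
begin

text \<open>
  The Stieltjes condition says that \<open>L\<close> charges only the zeros of \<open>H\<close>. Hence \<open>L\<close> has not grown
  since the last zero of \<open>H\<close> after \<open>a\<close>, or since \<open>a\<close> itself if there was none.
\<close>
lemma last_contact:
  assumes a: "0 \<le> a" "a \<le> t"
  obtains s where "s \<in> {a..t}" "L t = L s" "s = a \<or> H s = 0"
proof -
  have cont: "continuous_on {a..t} H"
    using path a continuous_on_subset[of "{0..}" H "{a..t}"] by (auto simp: inert_drift_path_def)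
  obtain s where s: "s \<in> {a..t}" "s = a \<or> H s = 0" "\<And>u. u \<in> {s<..t} \<Longrightarrow> H u \<noteq> 0"
  proof (cases "\<exists>u\<in>{a..t}. H u = 0")
    case True
    then show ?thesis using last_visit[OF cont] that by metis
  next
    case False
    then show ?thesis using that[of a] a by auto
  qed
  let ?N = "interval_measure (\<lambda>s. L (max 0 s))"
  have L_eq: "L r = (LINT u:{0..r}|?N. indicator {u. H u = 0} u)" if "r \<ge> 0" for r
    using path that by (simp add: inert_drift_path_def)
  have "L t = (LINT u:{0..t}|?N. indicator {u. H u = 0} u)" using a by (intro L_eq) auto
  \<comment> \<open>As \<open>H\<close> has no zero in \<open>{s<..t}\<close>, the two integrands are equal as functions on the whole line.\<close>
  also have "\<dots> = (LINT u:{0..s}|?N. indicator {u. H u = 0} u)"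
    unfolding set_lebesgue_integral_def using s
    by (intro Bochner_Integration.integral_cong) (auto simp: indicator_def)
  also have "\<dots> = L s" using a s by (intro L_eq[symmetric]) auto
  finally show thesis using s that by blast
qed

lemma path_in_state_space:
  assumes "0 \<le> t"
  shows "0 \<le> H t" and "- (g / \<gamma>) < V t"
proof -
  have "\<forall>t\<ge>0. (H t, V t) \<in> {0..} \<times> {- g / \<gamma><..}"
    using path unfolding inert_drift_path_def by (elim conjE)
  then show "0 \<le> H t" "- (g / \<gamma>) < V t" using assms by simp_all
qed

lemma velocity_integrable:
  assumes "0 \<le> s"
  shows "V integrable_on {s..t}"
  using path assms continuous_on_subset[of "{0..}" V "{s..t}"]
  by (auto simp: inert_drift_path_def intro: integrable_continuous_real)

lemma path_equations:
  assumes "0 \<le> t"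
  shows "H t = h + integral {0..t} V - b t + L t"
    and "V t = \<nu> - \<gamma> * integral {0..t} V - g * t + L t"
proof -
  show "H t = h + integral {0..t} V - b t + L t"
    using path assms by (simp add: inert_drift_path_def)
  have "integral {0..t} (\<lambda>u. \<gamma> * V u + g) = \<gamma> * integral {0..t} V + g * t"
    using velocity_integrable[of 0 t] assms
    by (subst Henstock_Kurzweil_Integration.integral_add) (auto intro: integrable_on_mult_right)
  then show "V t = \<nu> - \<gamma> * integral {0..t} V - g * t + L t"
    using path assms by (simp add: inert_drift_path_def)
qed

text \<open>
  Large velocities are acquired only through \<open>L\<close>, and \<open>V - H\<close> does not see \<open>L\<close>: its increments
  are those of \<open>b\<close> minus \<open>(1 + \<gamma>)\<close> times the displacement minus \<open>g\<close> times the elapsed time. The last two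
  contributions have a favourable sign while \<open>V \<ge> 0\<close>.
\<close>
lemma velocity_upper_bound:
  assumes "\<gamma> > 0" "g > 0" "0 \<le> t" and \<beta>: "\<And>u. u \<in> {0..t} \<Longrightarrow> \<bar>b u\<bar> \<le> \<beta>"
  shows "V t \<le> max (V 0) 0 + 2 * \<beta>"
proof -
  define c where "c = max (V 0) 0"
  have \<beta>0: "0 \<le> \<beta>" using order_trans[OF abs_ge_zero \<beta>[of 0]] assms(3) by simp
  have cont: "continuous_on {u..t} V" if "0 \<le> u" for u
    using path that continuous_on_subset[of "{0..}" V "{u..t}"] by (auto simp: inert_drift_path_def)
  show ?thesis
  proof (cases "V t \<le> c")
    case True
    then show ?thesis using \<beta>0 by (simp add: c_def)
  next
    case False
    have ivt: "\<exists>w\<in>{u..t}. V w = c" if "u \<in> {0..t}" "V u \<le> c" for u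
      using IVT'[of V u c t] that False cont[of u] by auto
    obtain u where "u \<in> {0..t}" "V u = c"
      using ivt[of 0] assms(3) by (force simp: c_def)
    then obtain s where s: "s \<in> {0..t}" "V s = c" "\<And>u. u \<in> {s<..t} \<Longrightarrow> V u \<noteq> c"
      using last_visit[OF cont[of 0]] by (metis order_refl)
    have above: "0 \<le> V u" if u: "u \<in> {s..t}" for u
    proof (rule ccontr)
      assume "\<not> 0 \<le> V u"
      then have less: "V u < c" by (simp add: c_def)
      then obtain w where "w \<in> {u..t}" "V w = c" using ivt[of u] s(1) u by force
      then show False using s u less by (cases "w = s") auto
    qed
    have mono: "integral {0..p} V \<le> integral {0..q} V" if "s \<le> p" "p \<le> q" "q \<le> t" for p q
    proof -
      have "integral {0..p} V + integral {p..q} V = integral {0..q} V"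
        using that s velocity_integrable[of 0 q]
        by (intro Henstock_Kurzweil_Integration.integral_combine) auto
      moreover have "0 \<le> integral {p..q} V"
        using that s velocity_integrable[of p q] above
        by (intro Henstock_Kurzweil_Integration.integral_nonneg) auto
      ultimately show ?thesis by simp
    qed
    obtain r where r: "r \<in> {s..t}" "L t = L r" "r = s \<or> H r = 0"
      using last_contact[of s t] s by auto
    have I: "integral {0..s} V \<le> integral {0..r} V" "integral {0..r} V \<le> integral {0..t} V"
      using mono[of s r] mono[of r t] r by auto
    have Hs: "0 \<le> H s" using path_in_state_space s by simp
    have mult: "\<gamma> * integral {0..s} V \<le> \<gamma> * integral {0..r} V"
      "\<gamma> * integral {0..r} V \<le> \<gamma> * integral {0..t} V" "g * s \<le> g * r" "g * r \<le> g * t"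
      using I assms r by (auto intro: mult_left_mono)
    \<comment> \<open>On \<open>[r, t]\<close> nothing pushes \<open>V\<close> up; on \<open>[s, r]\<close> one compares \<open>V - H\<close>, using \<open>H r = 0 \<le> H s\<close>.\<close>
    have "V t \<le> V r"
      using path_equations(2)[of t] path_equations(2)[of r] mult r s by auto
    moreover have "V r \<le> c + 2 * \<beta>"
      using r(3)
    proof
      assume "r = s" then show ?thesis using s \<beta>0 by simp
    next
      assume "H r = 0"
      then show ?thesis
        using path_equations[of r] path_equations[of s] mult(1,3) I(1) r s Hs \<beta>[of r] \<beta>[of s]
        by auto
    qed
    ultimately show ?thesis by (simp add: c_def)
  qed
qed

text \<open>
  Since the last contact \<open>s\<close> the velocity solves \<open>dV = - (\<gamma> * V + g) dt\<close>, so \<open>\<gamma>\<close> times the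
  displacement since \<open>s\<close> is at most \<open>V s - V t\<close>, which is bounded by \<open>velocity_upper_bound\<close> and by
  \<open>V t > - g / \<gamma>\<close>. No matter how long the excursion lasts, it cannot carry the gap further.
\<close>
lemma gap_upper_bound:
  assumes "\<gamma> > 0" "g > 0" "0 \<le> t" and \<beta>: "\<And>u. u \<in> {0..t} \<Longrightarrow> \<bar>b u\<bar> \<le> \<beta>"
  shows "H t \<le> H 0 + (max (V 0) 0 + 2 * \<beta> + g / \<gamma>) / \<gamma> + 2 * \<beta>"
proof -
  obtain s where s: "s \<in> {0..t}" "L t = L s" "s = 0 \<or> H s = 0"
    using last_contact[of 0 t] assms by auto
  have pos: "0 \<le> H 0" "- (g / \<gamma>) < V t" using path_in_state_space assms by simp_all
  have "V s \<le> max (V 0) 0 + 2 * \<beta>"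
    using s assms by (intro velocity_upper_bound) auto
  moreover have "g * s \<le> g * t" using s assms by (auto intro: mult_left_mono)
  ultimately have "\<gamma> * (integral {0..t} V - integral {0..s} V) \<le> max (V 0) 0 + 2 * \<beta> + g / \<gamma>"
    using path_equations(2)[of t] path_equations(2)[of s] s pos by (auto simp: algebra_simps)
  then have "integral {0..t} V - integral {0..s} V \<le> (max (V 0) 0 + 2 * \<beta> + g / \<gamma>) / \<gamma>"
    using assms by (simp add: pos_le_divide_eq mult.commute)
  moreover have "H s \<le> H 0" using s pos by auto
  ultimately show ?thesis
    using path_equations(1)[of t] path_equations(1)[of s] s \<beta>[of t] \<beta>[of s] by auto
qed

end

section \<open>Sublinear growth and the speed of a path\<close>

text \<open>
  For functions bounded on bounded intervals this is \<open>f t = o(t)\<close>. The uniform form over all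
  \<open>t \<ge> 0\<close> also controls the running maximum of \<open>\<bar>f\<bar>\<close>, which is what the bounds above need.
\<close>
definition sublinear :: "(real \<Rightarrow> real) \<Rightarrow> bool" where
  "sublinear f \<longleftrightarrow> (\<forall>\<epsilon>>0. \<exists>K. \<forall>t\<ge>0. \<bar>f t\<bar> \<le> K + \<epsilon> * t)"

lemma sublinear_imp_tendsto_0:
  assumes "sublinear f"
  shows "((\<lambda>t. f t / t) \<longlongrightarrow> 0) at_top"
proof (rule tendstoI)
  fix e :: real assume "e > 0"
  then obtain K where K: "\<And>t. t \<ge> 0 \<Longrightarrow> \<bar>f t\<bar> \<le> K + e / 2 * t"
    using assms unfolding sublinear_def by (meson half_gt_zero)
  have "eventually (\<lambda>t. t > max 1 (2 * K / e)) at_top" by (rule eventually_gt_at_top)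
  then show "eventually (\<lambda>t. dist (f t / t) 0 < e) at_top"
  proof eventually_elim
    case (elim t)
    then have "K < e / 2 * t" using \<open>e > 0\<close> by (simp add: field_simps)
    then have "\<bar>f t\<bar> < e * t" using K[of t] elim by simp
    then show ?case using elim by (simp add: dist_real_def pos_divide_less_eq)
  qed
qed

text \<open>
  The form in which the pathwise bounds are used: they hold for every horizon \<open>t\<close> and every bound
  \<open>\<beta>\<close> of \<open>\<bar>b\<bar>\<close> up to \<open>t\<close>, so \<open>\<beta>\<close> may be chosen as \<open>K + \<epsilon> / (A + 1) * t\<close>. Dividing by \<open>A + 1\<close>
  instead of \<open>A\<close> covers \<open>A = 0\<close>.
\<close>
lemma sublinear_dominated:
  assumes "sublinear b" "0 \<le> A"
    and bound: "\<And>t \<beta>. 0 \<le> t \<Longrightarrow> (\<And>u. u \<in> {0..t} \<Longrightarrow> \<bar>b u\<bar> \<le> \<beta>) \<Longrightarrow> \<bar>f t\<bar> \<le> C + A * \<beta>"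
  shows "sublinear f"
  unfolding sublinear_def
proof (intro allI impI)
  fix \<epsilon> :: real assume \<epsilon>: "\<epsilon> > 0"
  then obtain K where K: "\<And>t. t \<ge> 0 \<Longrightarrow> \<bar>b t\<bar> \<le> K + \<epsilon> / (A + 1) * t"
    using assms unfolding sublinear_def by (metis add_nonneg_pos divide_pos_pos zero_less_one)
  have "\<bar>f t\<bar> \<le> (C + A * K) + \<epsilon> * t" if t: "0 \<le> t" for t
  proof -
    have "\<bar>f t\<bar> \<le> C + A * (K + \<epsilon> / (A + 1) * t)"
    proof (rule bound[OF t])
      fix u assume u: "u \<in> {0..t}"
      have "\<bar>b u\<bar> \<le> K + \<epsilon> / (A + 1) * u" using K u by simp
      also have "\<dots> \<le> K + \<epsilon> / (A + 1) * t" using u \<epsilon> assms by (intro add_left_mono mult_left_mono) auto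
      finally show "\<bar>b u\<bar> \<le> K + \<epsilon> / (A + 1) * t" .
    qed
    also have "A * (\<epsilon> / (A + 1) * t) \<le> \<epsilon> * t"
    proof -
      have "A / (A + 1) * (\<epsilon> * t) \<le> 1 * (\<epsilon> * t)"
        using assms \<epsilon> t by (intro mult_right_mono) auto
      then show ?thesis by (simp add: ac_simps)
    qed
    then have "C + A * (K + \<epsilon> / (A + 1) * t) \<le> (C + A * K) + \<epsilon> * t" by (simp add: distrib_left)
    finally show ?thesis .
  qed
  then show "\<exists>K. \<forall>t\<ge>0. \<bar>f t\<bar> \<le> K + \<epsilon> * t" by blast
qed

text \<open>
  With \<open>b\<close>, \<open>H\<close> and \<open>V\<close> negligible against \<open>t\<close>, only the term \<open>- g * t\<close> survives in the relation
  that eliminates \<open>L\<close>.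
\<close>
lemma inert_drift_path_speed:
  assumes path: "inert_drift_path \<gamma> g h \<nu> b H V L" and pos: "\<gamma> > 0" "g > 0" and b: "sublinear b"
  shows "((\<lambda>t. integral {0..t} V / t) \<longlongrightarrow> - (g / (1 + \<gamma>))) at_top"
    and "((\<lambda>t. H t / t) \<longlongrightarrow> 0) at_top"
proof -
  have "sublinear V"
  proof (rule sublinear_dominated[OF b, of 2])
    fix t \<beta> assume t: "0 \<le> t" and \<beta>: "\<And>u. u \<in> {0..t} \<Longrightarrow> \<bar>b u\<bar> \<le> \<beta>"
    have "- (g / \<gamma>) < V t" using path_in_state_space[OF path t] by simp
    moreover have "0 \<le> g / \<gamma>" "0 \<le> \<beta>" using pos order_trans[OF abs_ge_zero \<beta>[of 0]] t by simp_all
    ultimately show "\<bar>V t\<bar> \<le> (max (V 0) 0 + g / \<gamma>) + 2 * \<beta>"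
      using velocity_upper_bound[OF path pos t \<beta>] by linarith
  qed simp
  note V = sublinear_imp_tendsto_0[OF this]
  have "sublinear H"
  proof (rule sublinear_dominated[OF b, of "2 / \<gamma> + 2"])
    fix t \<beta> assume t: "0 \<le> t" and \<beta>: "\<And>u. u \<in> {0..t} \<Longrightarrow> \<bar>b u\<bar> \<le> \<beta>"
    have "0 \<le> H t" using path_in_state_space[OF path t] by simp
    then show "\<bar>H t\<bar> \<le> (H 0 + (max (V 0) 0 + g / \<gamma>) / \<gamma>) + (2 / \<gamma> + 2) * \<beta>"
      using gap_upper_bound[OF path pos t \<beta>] by (simp add: add_divide_distrib algebra_simps)
  qed (use pos in simp)
  note H = sublinear_imp_tendsto_0[OF this]
  then show "((\<lambda>t. H t / t) \<longlongrightarrow> 0) at_top" .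
  have const: "((\<lambda>t. (\<nu> - h) / t) \<longlongrightarrow> 0) at_top"
    by (intro tendsto_divide_0[OF tendsto_const] filterlim_at_top_imp_at_infinity filterlim_ident)
  have "((\<lambda>t. (- g + b t / t + H t / t - V t / t + (\<nu> - h) / t) / (1 + \<gamma>)) \<longlongrightarrow>
      (- g + 0 + 0 - 0 + 0) / (1 + \<gamma>)) at_top"
    using pos by (intro tendsto_intros sublinear_imp_tendsto_0[OF b] H V const) auto
  moreover have "eventually (\<lambda>t. (- g + b t / t + H t / t - V t / t + (\<nu> - h) / t) / (1 + \<gamma>)
      = integral {0..t} V / t) at_top"
    using eventually_gt_at_top[of 0]
  proof eventually_elim
    case (elim t)
    have "(1 + \<gamma>) * integral {0..t} V = - g * t + b t + H t - V t + (\<nu> - h)"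
      using path_equations[OF path, of t] elim by (simp add: algebra_simps)
    then have "integral {0..t} V = (- g * t + b t + H t - V t + (\<nu> - h)) / (1 + \<gamma>)"
      using pos by (intro eq_divide_imp) (simp_all add: mult.commute)
    then have "integral {0..t} V / t = (- g * t + b t + H t - V t + (\<nu> - h)) / t / (1 + \<gamma>)"
      by simp
    then show ?case using elim by (simp add: add_divide_distrib diff_divide_distrib)
  qed
  ultimately show "((\<lambda>t. integral {0..t} V / t) \<longlongrightarrow> - (g / (1 + \<gamma>))) at_top"
    by (auto elim: Lim_transform_eventually)
qed

section \<open>Chaining over dyadic scales\<close>

text \<open>
  A grid point of level \<open>k + 1\<close> is either one of level \<open>k\<close> or the right neighbour of one, so it is
  reached from \<open>0\<close> by at most one increment from each level; the bounds add up to a geometric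
  series. Continuity extends the estimate from the dyadic grid to the interval.
\<close>
lemma dyadic_chaining_bound:
  fixes f :: "real \<Rightarrow> real"
  assumes cont: "continuous_on {0..T} f" and f0: "f 0 = 0" and \<rho>: "0 \<le> \<rho>" "\<rho> < 1" and T: "T > 0"
    and incr: "\<And>k j. j < 2 ^ k \<Longrightarrow>
      \<bar>f (real (Suc j) * T / 2 ^ k) - f (real j * T / 2 ^ k)\<bar> \<le> D * \<rho> ^ k"
    and x: "x \<in> {0..T}"
  shows "\<bar>f x\<bar> \<le> D / (1 - \<rho>)"
proof -
  have D: "0 \<le> D" using incr[of 0 0] by simp
  \<comment> \<open>The right-hand side is the partial geometric sum of \<open>D * \<rho> ^ i\<close> over \<open>i \<le> k\<close>.\<close>
  have grid: "\<bar>f (real j * T / 2 ^ k)\<bar> \<le> D * (1 - \<rho> ^ Suc k) / (1 - \<rho>)" if "j \<le> 2 ^ k" for j k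
    using that
  proof (induction k arbitrary: j)
    case 0
    then have "j = 0 \<or> j = 1" by auto
    then show ?case using incr[of 0 0] f0 D \<rho> by auto
  next
    case (Suc k)
    define i where "i = j div 2"
    have i: "real (2 * i) * T / 2 ^ Suc k = real i * T / 2 ^ k" by simp
    have step: "D * (1 - \<rho> ^ Suc k) / (1 - \<rho>) + D * \<rho> ^ Suc k = D * (1 - \<rho> ^ Suc (Suc k)) / (1 - \<rho>)"
      using \<rho> by (simp add: field_simps)
    have IH: "\<bar>f (real (2 * i) * T / 2 ^ Suc k)\<bar> \<le> D * (1 - \<rho> ^ Suc k) / (1 - \<rho>)"
      using Suc.IH[of i] Suc.prems unfolding i by (simp add: i_def)
    have nonneg: "0 \<le> D * \<rho> ^ Suc k" using D \<rho> by simp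
    show ?case
    proof (cases "even j")
      case True
      then have "j = 2 * i" by (simp add: i_def)
      then show ?thesis using IH step nonneg by (metis add_increasing2 order_refl order_trans)
    next
      case False
      then have "j = Suc (2 * i)" by (simp add: i_def)
      from this have j: "j = Suc (2 * i)" "2 * i < 2 ^ Suc k" using Suc.prems by simp_all
      have "\<bar>f (real j * T / 2 ^ Suc k)\<bar> \<le> \<bar>f (real (2 * i) * T / 2 ^ Suc k)\<bar> + D * \<rho> ^ Suc k"
        using abs_triangle_ineq2[of "f (real j * T / 2 ^ Suc k)" "f (real (2 * i) * T / 2 ^ Suc k)"]
          incr[of "2 * i" "Suc k"] j(2)
        unfolding j(1) by linarith
      then show ?thesis using IH step by linarith
    qed
  qed
  define y where "y k = real (nat \<lfloor>x * 2 ^ k / T\<rfloor>) * T / 2 ^ k" for k :: nat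
  have fl: "real (nat \<lfloor>x * 2 ^ k / T\<rfloor>) = of_int \<lfloor>x * 2 ^ k / T\<rfloor>" for k :: nat
    using x T by simp
  have y_bounds: "x - T * (1 / 2) ^ k \<le> y k" "y k \<le> x" for k
  proof -
    have "x * 2 ^ k / T - 1 \<le> of_int \<lfloor>x * 2 ^ k / T\<rfloor>" "of_int \<lfloor>x * 2 ^ k / T\<rfloor> \<le> x * 2 ^ k / T"
      by linarith+
    then have "(x * 2 ^ k / T - 1) * (T / 2 ^ k) \<le> y k" "y k \<le> (x * 2 ^ k / T) * (T / 2 ^ k)"
      using T unfolding y_def fl times_divide_eq_right[of _ T, symmetric]
      by (intro mult_right_mono; simp)+
    then show "x - T * (1 / 2) ^ k \<le> y k" "y k \<le> x"
      using T by (simp_all add: left_diff_distrib diff_divide_distrib power_divide)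
  qed
  have "y \<longlonglongrightarrow> x"
  proof (rule tendsto_sandwich)
    have "(\<lambda>k. x - T * (1 / 2) ^ k) \<longlonglongrightarrow> x - T * 0"
      by (intro tendsto_intros) simp
    then show "(\<lambda>k. x - T * (1 / 2) ^ k) \<longlonglongrightarrow> x" by simp
  qed (use y_bounds in auto)
  moreover have y_in: "y k \<in> {0..T}" for k
    using y_bounds(2)[of k] x T by (auto simp: y_def)
  ultimately have "(\<lambda>k. f (y k)) \<longlonglongrightarrow> f x"
    using x by (intro continuous_on_tendsto_compose[OF cont]) auto
  then have "(\<lambda>k. \<bar>f (y k)\<bar>) \<longlonglongrightarrow> \<bar>f x\<bar>" by (intro tendsto_intros)
  moreover have "\<bar>f (y k)\<bar> \<le> D / (1 - \<rho>)" for k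
  proof -
    have "real (nat \<lfloor>x * 2 ^ k / T\<rfloor>) \<le> 2 ^ k"
      using y_in[of k] T by (simp add: y_def field_simps)
    then have "nat \<lfloor>x * 2 ^ k / T\<rfloor> \<le> 2 ^ k"
      by (metis of_nat_le_iff of_nat_numeral of_nat_power)
    from grid[OF this] have "\<bar>f (y k)\<bar> \<le> D * (1 - \<rho> ^ Suc k) / (1 - \<rho>)" by (simp add: y_def)
    also have "\<dots> \<le> D / (1 - \<rho>)" using D \<rho> by (intro divide_right_mono) (auto simp: mult_left_le)
    finally show ?thesis .
  qed
  ultimately show ?thesis by (intro LIMSEQ_le_const2) auto
qed

text \<open>
  The growth rate \<open>3/2\<close> per doubling of the interval is smaller than \<open>2\<close>, so the chaining bound on
  \<open>[0, 2 ^ m]\<close> is \<open>o(2 ^ m)\<close>.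
\<close>
lemma sublinear_of_dyadic_increments:
  fixes f :: "real \<Rightarrow> real"
  assumes cont: "continuous_on {0..} f" and f0: "f 0 = 0"
    and incr: "\<And>m k j. j < 2 ^ k \<Longrightarrow>
      \<bar>f (real (Suc j) * 2 ^ m / 2 ^ k) - f (real j * 2 ^ m / 2 ^ k)\<bar> \<le> C * (3/2) ^ m * (9/10) ^ k"
  shows "sublinear f"
proof -
  have C: "0 \<le> C" using incr[of 0 0 0] by simp
  \<comment> \<open>The factor \<open>10\<close> is \<open>1 / (1 - 9/10)\<close>; below, \<open>15 = 10 * 3/2\<close> comes from passing from \<open>m\<close> to \<open>Suc m\<close>.\<close>
  have bound: "\<bar>f x\<bar> \<le> 10 * C * (3/2) ^ m" if "x \<in> {0..2 ^ m}" for x m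
    using dyadic_chaining_bound[of "2 ^ m" f "9/10" "C * (3/2) ^ m" x] that incr f0
      continuous_on_subset[OF cont, of "{0..2 ^ m}"] by simp
  show ?thesis
    unfolding sublinear_def
  proof (intro allI impI)
    fix \<epsilon> :: real assume \<epsilon>: "\<epsilon> > 0"
    have "(\<lambda>m. 15 * C * (3/4) ^ m) \<longlonglongrightarrow> 15 * C * 0"
      by (intro tendsto_intros) simp
    then have "eventually (\<lambda>m. 15 * C * (3/4) ^ m < \<epsilon>) sequentially"
      using \<epsilon> by (intro order_tendstoD) simp_all
    then obtain m0 where m0: "\<And>m. m \<ge> m0 \<Longrightarrow> 15 * C * (3/4) ^ m < \<epsilon>"
      by (auto simp: eventually_sequentially)
    have "\<bar>f t\<bar> \<le> 10 * C * (3/2) ^ m0 + \<epsilon> * t" if t: "0 \<le> t" for t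
    proof (cases "t \<le> 2 ^ m0")
      case True
      then show ?thesis using bound[of t m0] t \<epsilon> by (smt (verit) atLeastAtMost_iff mult_nonneg_nonneg)
    next
      case False
      define n where "n = (LEAST n. t \<le> 2 ^ n)"
      have ex: "\<exists>n. t \<le> 2 ^ n"
        using real_arch_pow[of 2 t] by (auto intro: less_imp_le)
      have tn: "t \<le> 2 ^ n" unfolding n_def using ex by (rule LeastI_ex)
      have "m0 < n"
        using tn False power_increasing[of n m0 "2::real"] by (intro not_le_imp_less notI) linarith
      then obtain m where m: "n = Suc m" "m0 \<le> m" by (cases n) auto
      have lower: "2 ^ m < t"
        using not_less_Least[of m "\<lambda>n. t \<le> 2 ^ n"] m(1) by (simp add: n_def[symmetric] not_le)
      have "\<bar>f t\<bar> \<le> 10 * C * (3/2) ^ Suc m" using bound[of t n] tn t m by simp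
      also have "\<dots> = (15 * C * (3/4) ^ m) * 2 ^ m"
        by (simp add: power_mult_distrib[symmetric] mult.assoc)
      also have "\<dots> \<le> \<epsilon> * t"
        using m0[OF m(2)] lower C \<epsilon> by (intro mult_mono) auto
      finally show ?thesis using C by (simp add: add_increasing)
    qed
    then show "\<exists>K. \<forall>t\<ge>0. \<bar>f t\<bar> \<le> K + \<epsilon> * t" by blast
  qed
qed

section \<open>Brownian paths are sublinear\<close>
lemma (in standard_brownian_motion) increment_fourth_moment:
  assumes "0 \<le> s" "s < t"
  shows "(\<integral>\<^sup>+\<omega>. ennreal ((B t \<omega> - B s \<omega>) ^ 4) \<partial>M) = ennreal (3 * (t - s)\<^sup>2)"
proof -
  let ?d = "normal_density 0 (sqrt (t - s))"
  have "(\<integral>\<^sup>+\<omega>. ennreal ((B t \<omega> - B s \<omega>) ^ 4) \<partial>M) = (\<integral>\<^sup>+x. ?d x * ennreal (x ^ 4) \<partial>lborel)"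
    by (intro distributed_nn_integral[OF gaussian_increments, symmetric] assms) auto
  also have "\<dots> = (\<integral>\<^sup>+x. ennreal (?d x * (x - 0) ^ (2 * 2)) \<partial>lborel)"
    by (auto intro!: nn_integral_cong simp: ennreal_mult)
  also have "\<dots> = ennreal (fact (2 * 2) / ((2 / (sqrt (t - s))\<^sup>2) ^ 2 * fact 2))"
    using assms
    by (subst nn_integral_eq_integral[OF integrable.intros[OF normal_moment_even]])
       (simp, simp, subst integral_normal_moment_even, simp_all)
  also have "\<dots> = ennreal (3 * (t - s)\<^sup>2)"
    using assms by (simp add: fact_numeral power_divide)
  finally show ?thesis .
qed

text \<open>
  Divide each increment by its claimed order \<open>(3/2) ^ m * (9/10) ^ k\<close> and add up all fourth powers.
  There are \<open>2 ^ k\<close> increments at level \<open>k\<close>, each of fourth moment \<open>3 * (2 ^ m / 2 ^ k)\<^sup>2\<close>, so the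
  expected sum is a product of two geometric series with ratios \<open>4 / (3/2) ^ 4\<close> in \<open>m\<close> and
  \<open>1 / (2 * (9/10) ^ 4)\<close> in \<open>k\<close>. Both ratios are below \<open>1\<close>: any base \<open>c\<close> with \<open>4 < c ^ 4\<close> in place of
  \<open>3/2\<close> and any \<open>\<rho>\<close> with \<open>1/2 < \<rho> ^ 4\<close> in place of \<open>9/10\<close> would do here, while the chaining needs
  \<open>c < 2\<close> and \<open>\<rho> < 1\<close>. Hence the sum is almost surely finite, and it bounds each of its terms.
\<close>
lemma (in standard_brownian_motion) dyadic_increments_bounded:
  "AE \<omega> in M. \<exists>C. \<forall>m k j. j < 2 ^ k \<longrightarrow>
     \<bar>B (real (Suc j) * 2 ^ m / 2 ^ k) \<omega> - B (real j * 2 ^ m / 2 ^ k) \<omega>\<bar> \<le> C * (3/2) ^ m * (9/10) ^ k"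
proof -
  define w :: "nat \<Rightarrow> nat \<Rightarrow> real" where "w m k = (3/2) ^ m * (9/10) ^ k" for m k
  define \<Delta> where "\<Delta> m k j \<omega> = B (real (Suc j) * 2 ^ m / 2 ^ k) \<omega> - B (real j * 2 ^ m / 2 ^ k) \<omega>"
    for m k j :: nat and \<omega>
  define X where "X m k j \<omega> = ennreal ((\<Delta> m k j \<omega> / w m k) ^ 4)" for m k j \<omega>
  define Z where "Z \<omega> = (\<Sum>m. \<Sum>k. \<Sum>j<2^k. X m k j \<omega>)" for \<omega>
  have w: "w m k > 0" for m k by (simp add: w_def)
  have B_meas: "B t \<in> borel_measurable M" if "0 \<le> t" for t
    using random_variable_B[OF that] .
  have X_meas: "X m k j \<in> borel_measurable M" for m k j
    unfolding X_def \<Delta>_def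
    by (intro measurable_compose[OF _ measurable_ennreal] borel_measurable_power
        borel_measurable_divide borel_measurable_diff B_meas borel_measurable_const) auto
  have X_int: "(\<integral>\<^sup>+\<omega>. X m k j \<omega> \<partial>M) = ennreal (3 * (2 ^ m / 2 ^ k)\<^sup>2 / w m k ^ 4)" for m k j
  proof -
    have diff: "real (Suc j) * 2 ^ m / 2 ^ k - real j * 2 ^ m / 2 ^ k = 2 ^ m / 2 ^ k"
      by (simp add: field_simps)
    have "(\<integral>\<^sup>+\<omega>. X m k j \<omega> \<partial>M) = (\<integral>\<^sup>+\<omega>. ennreal (1 / w m k ^ 4) * ennreal (\<Delta> m k j \<omega> ^ 4) \<partial>M)"
      using w by (intro nn_integral_cong) (simp add: X_def power_divide ennreal_mult[symmetric])
    also have "\<dots> = ennreal (1 / w m k ^ 4) * (\<integral>\<^sup>+\<omega>. ennreal (\<Delta> m k j \<omega> ^ 4) \<partial>M)"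
      unfolding \<Delta>_def
      by (intro nn_integral_cmult measurable_compose[OF _ measurable_ennreal] borel_measurable_power
        borel_measurable_diff B_meas) auto
    also have "(\<integral>\<^sup>+\<omega>. ennreal (\<Delta> m k j \<omega> ^ 4) \<partial>M) = ennreal (3 * (2 ^ m / 2 ^ k)\<^sup>2)"
      unfolding \<Delta>_def by (subst increment_fourth_moment) (simp_all only: diff, auto simp: divide_strict_right_mono)
    finally show ?thesis using w by (simp add: ennreal_mult[symmetric])
  qed
  define p :: real where "p = 2\<^sup>2 / (3/2) ^ 4"
  define q :: real where "q = 1 / (2 * (9/10) ^ 4)"
  have pq: "0 \<le> p" "p < 1" "0 \<le> q" "q < 1" by (simp_all add: p_def q_def power_divide)
  have "(\<integral>\<^sup>+\<omega>. Z \<omega> \<partial>M) = (\<Sum>m. \<Sum>k. \<Sum>j<(2::nat)^k. ennreal (3 * (2 ^ m / 2 ^ k)\<^sup>2 / w m k ^ 4))"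
    unfolding Z_def using X_meas by (simp add: nn_integral_suminf nn_integral_sum X_int)
  also have "\<dots> = (\<Sum>m. \<Sum>k. ennreal (3 * p ^ m * q ^ k))"
  proof (intro suminf_cong)
    fix m k :: nat
    have "p ^ m = (2 ^ m)\<^sup>2 / ((3/2) ^ m) ^ 4" "q ^ k = 1 / (2 ^ k * ((9/10) ^ k) ^ 4)"
      unfolding p_def q_def power_divide power_mult_distrib power_one
      by (simp_all only: power_mult[symmetric] mult.commute)
    moreover have "y * (3 * (x / y)\<^sup>2 / (u * v) ^ 4) = 3 * (x\<^sup>2 / u ^ 4) * (1 / (y * v ^ 4))"
      if "y \<noteq> 0" for x y u v :: real
      using that by (simp add: power_divide power_mult_distrib power2_eq_square)
    ultimately have "2 ^ k * (3 * (2 ^ m / 2 ^ k)\<^sup>2 / w m k ^ 4) = 3 * p ^ m * q ^ k"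
      unfolding w_def by simp
    then show "(\<Sum>j<(2::nat)^k. ennreal (3 * (2 ^ m / 2 ^ k)\<^sup>2 / w m k ^ 4)) = ennreal (3 * p ^ m * q ^ k)"
      by (subst sum_ennreal) (auto intro!: divide_nonneg_pos simp: w)
  qed
  also have "\<dots> = (\<Sum>m. ennreal (3 * p ^ m / (1 - q)))"
  proof (intro suminf_cong suminf_ennreal_eq)
    fix m
    show "(\<lambda>k. 3 * p ^ m * q ^ k) sums (3 * p ^ m / (1 - q))"
      using sums_mult[OF geometric_sums[of q], of "3 * p ^ m"] pq by simp
  qed (use pq in auto)
  also have "\<dots> = ennreal (3 / (1 - q) * (1 / (1 - p)))"
  proof (intro suminf_ennreal_eq)
    show "(\<lambda>m. 3 * p ^ m / (1 - q)) sums (3 / (1 - q) * (1 / (1 - p)))"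
      using sums_mult[OF geometric_sums[of p], of "3 / (1 - q)"] pq by simp
  qed (use pq in auto)
  finally have "(\<integral>\<^sup>+\<omega>. Z \<omega> \<partial>M) \<noteq> \<infinity>" by simp
  moreover have "Z \<in> borel_measurable M"
    unfolding Z_def using X_meas by measurable
  ultimately have "AE \<omega> in M. Z \<omega> \<noteq> \<infinity>" by (intro nn_integral_PInf_AE)
  then show ?thesis
  proof eventually_elim
    case (elim \<omega>)
    then obtain z where z: "Z \<omega> = ennreal z" "z \<ge> 0" by (cases "Z \<omega>") auto
    have "\<bar>\<Delta> m k j \<omega>\<bar> \<le> (1 + z) * w m k" if "j < 2 ^ k" for m k j
    proof -
      have "X m k j \<omega> \<le> (\<Sum>j<2^k. X m k j \<omega>)" using that by (intro member_le_sum) auto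
      also have "\<dots> \<le> (\<Sum>k. \<Sum>j<2^k. X m k j \<omega>)" using sum_le_suminf[of "\<lambda>k. \<Sum>j<2^k. X m k j \<omega>" "{k}"] by simp
      also have "\<dots> \<le> Z \<omega>"
        unfolding Z_def using sum_le_suminf[of "\<lambda>m. \<Sum>k. \<Sum>j<2^k. X m k j \<omega>" "{m}"] by simp
      finally have "(\<bar>\<Delta> m k j \<omega>\<bar> / w m k) ^ 4 \<le> z"
        using z by (simp add: X_def power_divide)
      \<comment> \<open>\<open>x ^ 4 \<le> z\<close> gives \<open>x \<le> 1 + z\<close>, since either \<open>x \<le> 1\<close> or \<open>x \<le> x ^ 4\<close>.\<close>
      then have "\<bar>\<Delta> m k j \<omega>\<bar> / w m k \<le> 1 + z"
        using self_le_power[of "\<bar>\<Delta> m k j \<omega>\<bar> / w m k" 4] z(2)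
        by (cases "1 \<le> \<bar>\<Delta> m k j \<omega>\<bar> / w m k") auto
      then show ?thesis using w by (simp add: pos_divide_le_eq)
    qed
    then show ?case
      by (intro exI[of _ "1 + z"]) (simp add: \<Delta>_def w_def mult.assoc)
  qed
qed

lemma (in standard_brownian_motion) sublinear_paths:
  "AE \<omega> in M. sublinear (\<lambda>t. B t \<omega>)"
  using dyadic_increments_bounded starts_at_zero continuous_paths
proof eventually_elim
  case (elim \<omega>)
  then show ?case using sublinear_of_dyadic_increments[of "\<lambda>t. B t \<omega>"] by blast
qed

section \<open>Almost sure speed\<close>
theorem theorem1p5:
  fixes M :: "'a measure" and B H V L :: "real \<Rightarrow> 'a \<Rightarrow> real" and \<gamma> g h \<nu> :: real
  assumes "\<gamma> > 0" and "g > 0"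
    and "(h, \<nu>) \<in> {0..} \<times> {- g / \<gamma><..}"
    and "inert_drift_process M B \<gamma> g h \<nu> H V L"
  shows "AE \<omega> in M.
    ((\<lambda>t. inert_trajectory V t \<omega> / t) \<longlongrightarrow> - (g / (1 + \<gamma>))) at_top \<and>
    ((\<lambda>t. brownian_trajectory H V t \<omega> / t) \<longlongrightarrow> - (g / (1 + \<gamma>))) at_top"
proof -
  interpret inert_drift_process M B \<gamma> g h \<nu> H V L by fact
  show ?thesis
    using solution_paths sublinear_paths
  proof eventually_elim
    case (elim \<omega>)
    note speed = inert_drift_path_speed[OF elim(1) assms(1,2) elim(2)]
    show ?case
      using speed(1) tendsto_diff[OF speed]
      by (simp add: inert_trajectory_def brownian_trajectory_def diff_divide_distrib)
  qed
qed

end
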